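(* Suppose all items in the input sequence have size at most $1/d$ for a real $d\ge 2$. Then Worst Fit is absolutely $(1+d/(d-1))$-competitive for Black and White Bin Packing, i.e., it uses at most $(1+d/(d-1))\cdot\mathrm{OPT}(L)$ bins on every such input $L$.
   Context: Black and White Bin Packing: items arrive as a sequence; each item has a size in $[0,1]$ and a color that is either black or white. A packing places items into unit-capacity bins, items in a bin ordered by arrival; it is valid if each bin has total size at most $1$ and no two consecutive items in a bin have the same color. $\mathrm{OPT}(L)$ is the minimum number of bins in a valid packing of $L$ without reordering. Worst Fit is the online algorithm that packs each incoming item into a bin of lowest current level (total size of its items) among the bins into which the item can be validly added, and opens a new bin only if there is no such bin. *)

theory Defs
  imports Complex_Main
begin

datatype color = Black | White

datatype item = Item (item_size: real) (item_color: color)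

text \<open>A bin is the list of its items in order of arrival.\<close>

definition level :: "item list \<Rightarrow> real" where
  "level b = sum_list (map item_size b)"

definition valid_bin :: "item list \<Rightarrow> bool" where
  "valid_bin b \<longleftrightarrow> level b \<le> 1 \<and> successively (\<lambda>x y. item_color x \<noteq> item_color y) b"

text \<open>A packing of \<open>L\<close> is given by a function \<open>f\<close> on positions, where \<open>f i\<close> is the name of the
  bin that receives the item \<open>L ! i\<close>; only the values at \<open>i < length L\<close> matter.\<close>

definition bin :: "item list \<Rightarrow> (nat \<Rightarrow> nat) \<Rightarrow> nat \<Rightarrow> item list" where
  "bin L f b = nths L {i. f i = b}"

definition bins_used :: "item list \<Rightarrow> (nat \<Rightarrow> nat) \<Rightarrow> nat set" where
  "bins_used L f = f ` {..<length L}"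

definition valid_packing :: "item list \<Rightarrow> (nat \<Rightarrow> nat) \<Rightarrow> bool" where
  "valid_packing L f \<longleftrightarrow> (\<forall>b \<in> bins_used L f. valid_bin (bin L f b))"

definition OPT :: "item list \<Rightarrow> nat" where
  "OPT L = (LEAST n. \<exists>f. valid_packing L f \<and> card (bins_used L f) = n)"

text \<open>Open bins into which \<open>x\<close> can be validly added once the items in \<open>L\<close> have been packed
  according to \<open>f\<close>.\<close>

definition feasible_bins :: "item list \<Rightarrow> (nat \<Rightarrow> nat) \<Rightarrow> item \<Rightarrow> nat set" where
  "feasible_bins L f x = {b \<in> bins_used L f. valid_bin (bin L f b @ [x])}"

text \<open>The packings Worst Fit may produce on \<open>L\<close>. Ties between bins of lowest level may be broken
  arbitrarily, so there can be several.\<close>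

definition worst_fit :: "item list \<Rightarrow> (nat \<Rightarrow> nat) \<Rightarrow> bool" where
  "worst_fit L f \<longleftrightarrow>
    (\<forall>i < length L.
      let P = take i L; F = feasible_bins P f (L ! i) in
        if F = {} then f i \<notin> bins_used P f
        else is_arg_min (\<lambda>b. level (bin P f b)) (\<lambda>b. b \<in> F) (f i))"

lemma OPT_attained:
  assumes "\<forall>x \<in> set L. item_size x \<le> 1"
  shows "\<exists>f. valid_packing L f \<and> card (bins_used L f) = OPT L"
proof -
  have "valid_bin (bin L id b)" if "b < length L" for b
  proof -
    have "nths L {b} = [L ! b]"
      using that
    proof (induction L arbitrary: b)
      case (Cons a L)
      then show ?case
        by (cases b) (auto simp: nths_Cons)
    qed simp
    then show ?thesis
      using that assms by (simp add: bin_def valid_bin_def level_def)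
  qed
  then have "valid_packing L id"
    by (auto simp: valid_packing_def bins_used_def)
  then have "\<exists>n f. valid_packing L f \<and> card (bins_used L f) = n"
    by blast
  then show ?thesis
    unfolding OPT_def by (rule LeastI_ex)
qed

lemma bins_cong:
  assumes "\<And>i. i < length L \<Longrightarrow> f i = g i"
  shows "bins_used L f = bins_used L g" and "bin L f b = bin L g b"
proof -
  show "bins_used L f = bins_used L g"
    using assms by (auto simp: bins_used_def)
  show "bin L f b = bin L g b"
    using assms unfolding bin_def nths_def
    by (intro arg_cong[where f = "map fst"] filter_cong) (auto simp: set_zip)
qed

lemma feasible_bins_cong:
  assumes "\<And>i. i < length L \<Longrightarrow> f i = g i"
  shows "feasible_bins L f x = feasible_bins L g x"
  using bins_cong[OF assms] by (simp add: feasible_bins_def)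

lemma worst_fit_exists: "\<exists>f. worst_fit L f"
proof (induction L rule: rev_induct)
  case Nil
  show ?case by (simp add: worst_fit_def)
next
  case (snoc x L)
  then obtain f where f: "worst_fit L f" by blast
  define F where "F = feasible_bins L f x"
  have fin: "finite (bins_used L f)" "finite F"
    by (auto simp: bins_used_def F_def feasible_bins_def)
  have "\<exists>b. if F = {} then b \<notin> bins_used L f
            else is_arg_min (\<lambda>b. level (bin L f b)) (\<lambda>b. b \<in> F) b"
    using ex_is_arg_min_if_finite[OF fin(2)] ex_new_if_finite[OF infinite_UNIV_nat fin(1)]
    by auto
  then obtain b where b: "if F = {} then b \<notin> bins_used L f
            else is_arg_min (\<lambda>b. level (bin L f b)) (\<lambda>b. b \<in> F) b" ..
  define g where "g = f(length L := b)"
  have cong: "bins_used (take i L) g = bins_used (take i L) f"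
    "bin (take i L) g c = bin (take i L) f c"
    "feasible_bins (take i L) g y = feasible_bins (take i L) f y" for i c y
    by (rule bins_cong feasible_bins_cong; simp add: g_def)+
  have "worst_fit (L @ [x]) g"
    unfolding worst_fit_def
  proof (intro allI impI)
    fix i assume "i < length (L @ [x])"
    then consider "i < length L" | "i = length L" by fastforce
    then show "let P = take i (L @ [x]); F = feasible_bins P g ((L @ [x]) ! i) in
        if F = {} then g i \<notin> bins_used P g
        else is_arg_min (\<lambda>b. level (bin P g b)) (\<lambda>b. b \<in> F) (g i)"
    proof cases
      case 1
      then have "g i = f i" by (simp add: g_def)
      with 1 f show ?thesis
        by (simp add: worst_fit_def nth_append cong Let_def)
    next
      case 2
      then show ?thesis
        using b cong[of "length L"] by (simp add: g_def F_def Let_def split: if_splits)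
    qed
  qed
  then show ?case by blast
qed

end

theory Submission
  imports Defs "HOL-Library.Sublist"
begin

text \<open>
  Call a bin small if its level is at most \<open>1 - t\<close>, where \<open>t = 1/d\<close> bounds the item sizes, so that
  any item of the opposite colour still fits; otherwise it is big. As the total size is at most
  \<open>OPT\<close>, there are at most \<open>OPT / (1 - t)\<close> big bins. Worst Fit puts an item of colour different
  from \<open>c\<close> on a small bin with top colour \<open>c\<close> as long as there is one. Hence the number of those
  bins is dominated by a walk with steps \<open>\<plusminus>1\<close> reflected at zero, i.e. by the excess of \<open>c\<close>-items
  over the other ones in some suffix of the input. Adding the two bounds for black and white, the
  common part of the two suffixes cancels, and what remains is the excess of one colour in a
  contiguous segment. In a valid packing each bin contributes at most one to this excess, so there
  are at most \<open>OPT\<close> small bins.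
\<close>

lemma color_neq_iff: "a \<noteq> b \<longleftrightarrow> (a = c \<longleftrightarrow> b \<noteq> c)" for a b c :: color
  by (cases a; cases b; cases c) auto

abbreviation alternating :: "item list \<Rightarrow> bool" where
  "alternating \<equiv> successively (\<lambda>x y. item_color x \<noteq> item_color y)"

definition excess :: "color \<Rightarrow> item list \<Rightarrow> int" where
  "excess c xs = (\<Sum>x\<leftarrow>xs. if item_color x = c then 1 else - 1)"

lemma excess_Nil [simp]: "excess c [] = 0"
  by (simp add: excess_def)

lemma excess_Cons [simp]:
  "excess c (x # xs) = (if item_color x = c then 1 else - 1) + excess c xs"
  by (simp add: excess_def)

lemma excess_append [simp]: "excess c (xs @ ys) = excess c xs + excess c ys"
  by (simp add: excess_def)

lemma excess_White: "excess White xs = - excess Black xs"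
proof (induction xs)
  case (Cons x xs)
  then show ?case by (cases "item_color x") auto
qed simp

lemma excess_alternating:
  assumes "alternating xs"
  shows "excess c xs =
    (if even (length xs) then 0 else if item_color (hd xs) = c then 1 else - 1)"
  using assms
proof (induction xs)
  case (Cons x xs)
  then show ?case
  proof (cases xs)
    case (Cons y ys)
    then have "item_color x \<noteq> item_color y" and "alternating xs"
      using Cons.prems by auto
    then have "item_color x = c \<longleftrightarrow> item_color y \<noteq> c"
      using color_neq_iff by blast
    then show ?thesis
      using Cons.IH[OF \<open>alternating xs\<close>] Cons by auto
  qed simp
qed simp

corollary abs_excess_alternating_le_1: "alternating xs \<Longrightarrow> \<bar>excess c xs\<bar> \<le> 1"
  by (simp add: excess_alternating)

lemma level_Nil [simp]: "level [] = 0"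
  by (simp add: level_def)

lemma level_append [simp]: "level (xs @ ys) = level xs + level ys"
  by (simp add: level_def)

lemma level_singleton [simp]: "level [x] = item_size x"
  by (simp add: level_def)

lemma valid_bin_snoc_iff:
  "valid_bin (b @ [x]) \<longleftrightarrow> level b + item_size x \<le> 1 \<and> alternating b \<and>
    (b \<noteq> [] \<longrightarrow> item_color (last b) \<noteq> item_color x)"
  by (auto simp: valid_bin_def successively_append_iff)

lemma finite_bins_used [simp]: "finite (bins_used L f)"
  by (simp add: bins_used_def)

lemma bins_used_Nil [simp]: "bins_used [] f = {}"
  by (simp add: bins_used_def)

lemma bins_used_snoc: "bins_used (L @ [x]) f = insert (f (length L)) (bins_used L f)"
  by (auto simp: bins_used_def lessThan_Suc)

lemma bin_snoc: "bin (L @ [x]) f b = bin L f b @ (if f (length L) = b then [x] else [])"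
  by (simp add: bin_def nths_append)

lemma bin_eq_Nil_iff: "bin L f b = [] \<longleftrightarrow> b \<notin> bins_used L f"
proof (induction L rule: rev_induct)
  case Nil
  show ?case by (simp add: bin_def)
qed (auto simp: bin_snoc bins_used_snoc)

lemma sum_list_nths_fibres:
  fixes h :: "'a \<Rightarrow> 'b::comm_monoid_add"
  assumes "finite B" and "k ` {..<length xs} \<subseteq> B"
  shows "(\<Sum>b\<in>B. sum_list (map h (nths xs {i. k i = b}))) = sum_list (map h xs)"
  using assms(2)
proof (induction xs rule: rev_induct)
  case (snoc x xs)
  have "(\<Sum>b\<in>B. sum_list (map h (nths (xs @ [x]) {i. k i = b})))
      = (\<Sum>b\<in>B. sum_list (map h (nths xs {i. k i = b})) + (if k (length xs) = b then h x else 0))"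
    by (intro sum.cong) (auto simp: nths_append)
  also have "\<dots> = sum_list (map h xs) + h x"
    using snoc assms(1) by (auto simp: sum.distrib image_subset_iff)
  finally show ?case by simp
qed simp

lemma sum_level_bins: "(\<Sum>b\<in>bins_used L f. level (bin L f b)) = level L"
  unfolding level_def bin_def by (rule sum_list_nths_fibres) (auto simp: bins_used_def)

lemma level_le_card_bins_used:
  assumes "valid_packing L g"
  shows "level L \<le> real (card (bins_used L g))"
proof -
  have "(\<Sum>b\<in>bins_used L g. level (bin L g b)) \<le> (\<Sum>b\<in>bins_used L g. 1)"
    using assms by (intro sum_mono) (auto simp: valid_packing_def valid_bin_def)
  then show ?thesis by (simp add: sum_level_bins)
qed

lemma abs_excess_sublist_le_card_bins_used:
  assumes "valid_packing L g" and "sublist vs L"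
  shows "\<bar>excess c vs\<bar> \<le> int (card (bins_used L g))"
proof -
  obtain us ws where L: "L = us @ vs @ ws"
    using assms(2) by (auto simp: sublist_def)
  define part where "part b = nths vs {i. g (i + length us) = b}" for b
  have part_le: "\<bar>excess c (part b)\<bar> \<le> 1" if "b \<in> bins_used L g" for b
  proof -
    have "alternating (bin L g b)"
      using assms(1) that by (auto simp: valid_packing_def valid_bin_def)
    then have "alternating (part b)"
      by (auto simp: L bin_def part_def nths_append successively_append_iff)
    then show ?thesis by (rule abs_excess_alternating_le_1)
  qed
  have "excess c vs = (\<Sum>b\<in>bins_used L g. excess c (part b))"
    unfolding excess_def part_def
    by (rule sum_list_nths_fibres[symmetric]) (auto simp: L bins_used_def)
  also have "\<bar>\<dots>\<bar> \<le> (\<Sum>b\<in>bins_used L g. \<bar>excess c (part b)\<bar>)"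
    by (rule sum_abs)
  also have "\<dots> \<le> (\<Sum>b\<in>bins_used L g. 1)"
    using part_le by (intro sum_mono)
  finally show ?thesis by simp
qed

lemma excess_suffixes_le_card_bins_used:
  assumes "valid_packing L g" and "suffix bs L" and "suffix ws L"
  shows "excess Black bs + excess White ws \<le> int (card (bins_used L g))"
proof -
  obtain us where "sublist us L"
    and "\<bar>excess Black bs - excess Black ws\<bar> = \<bar>excess Black us\<bar>"
  proof -
    consider us where "ws = us @ bs" | us where "bs = us @ ws"
      using suffix_same_cases[OF assms(2,3)] by (auto simp: suffix_def)
    then show thesis
    proof cases
      case 1
      then have "sublist us L"
        using assms(3) by (auto simp: suffix_def)
      then show thesis by (rule that) (simp add: 1)
    next
      case 2
      then have "sublist us L"
        using assms(2) by (auto simp: suffix_def)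
      then show thesis by (rule that) (simp add: 2)
    qed
  qed
  then show ?thesis
    using abs_excess_sublist_le_card_bins_used[OF assms(1), of us Black]
    by (simp add: excess_White)
qed

definition worst_fit_choice :: "item list \<Rightarrow> (nat \<Rightarrow> nat) \<Rightarrow> item \<Rightarrow> nat \<Rightarrow> bool" where
  "worst_fit_choice L f x b \<longleftrightarrow>
    (if feasible_bins L f x = {} then b \<notin> bins_used L f
     else is_arg_min (\<lambda>b'. level (bin L f b')) (\<lambda>b'. b' \<in> feasible_bins L f x) b)"

lemma worst_fit_snoc_iff:
  "worst_fit (L @ [x]) f \<longleftrightarrow> worst_fit L f \<and> worst_fit_choice L f x (f (length L))"
proof -
  have worst_fit_iff:
    "worst_fit xs f \<longleftrightarrow> (\<forall>i < length xs. worst_fit_choice (take i xs) f (xs ! i) (f i))" for xs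
    by (simp add: worst_fit_def worst_fit_choice_def Let_def)
  show ?thesis
    unfolding worst_fit_iff by (auto simp: less_Suc_eq nth_append)
qed

lemma worst_fit_choice_valid_bin:
  assumes "worst_fit_choice L f x b" and "item_size x \<le> 1"
  shows "valid_bin (bin L f b @ [x])"
proof (cases "feasible_bins L f x = {}")
  case True
  then have "bin L f b = []"
    using assms(1) by (simp add: worst_fit_choice_def bin_eq_Nil_iff)
  then show ?thesis
    using assms(2) by (simp add: valid_bin_def)
next
  case False
  then have "b \<in> feasible_bins L f x"
    using assms(1) by (simp add: worst_fit_choice_def is_arg_min_def)
  then show ?thesis
    by (simp add: feasible_bins_def)
qed

lemma worst_fit_choice_least_level:
  assumes "worst_fit_choice L f x b" and "b' \<in> feasible_bins L f x"
  shows "b \<in> feasible_bins L f x" and "level (bin L f b) \<le> level (bin L f b')"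
  using assms by (auto simp: worst_fit_choice_def is_arg_min_linorder split: if_splits)

lemma worst_fit_valid_packing:
  assumes "worst_fit L f" and "\<forall>x \<in> set L. item_size x \<le> 1"
  shows "valid_packing L f"
  using assms
proof (induction L rule: rev_induct)
  case Nil
  show ?case by (simp add: valid_packing_def)
next
  case (snoc x L)
  then have "valid_packing L f" and "valid_bin (bin L f (f (length L)) @ [x])"
    by (auto simp: worst_fit_snoc_iff worst_fit_choice_valid_bin)
  then show ?case
    by (auto simp: valid_packing_def bins_used_snoc bin_snoc)
qed

definition big_bins :: "real \<Rightarrow> item list \<Rightarrow> (nat \<Rightarrow> nat) \<Rightarrow> nat set" where
  "big_bins t L f = {b \<in> bins_used L f. level (bin L f b) > 1 - t}"

definition small_bins :: "real \<Rightarrow> color \<Rightarrow> item list \<Rightarrow> (nat \<Rightarrow> nat) \<Rightarrow> nat set" where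
  "small_bins t c L f =
    {b \<in> bins_used L f. level (bin L f b) \<le> 1 - t \<and> item_color (last (bin L f b)) = c}"

lemma finite_small_bins [simp]: "finite (small_bins t c L f)"
  by (simp add: small_bins_def)

lemma card_bins_used_eq_small_big:
  "card (bins_used L f) =
    card (small_bins t Black L f) + card (small_bins t White L f) + card (big_bins t L f)"
proof -
  have "bins_used L f = (small_bins t Black L f \<union> small_bins t White L f) \<union> big_bins t L f"
    by (auto simp: small_bins_def big_bins_def) (metis color.exhaust)
  moreover have "small_bins t Black L f \<inter> small_bins t White L f = {}"
    and "(small_bins t Black L f \<union> small_bins t White L f) \<inter> big_bins t L f = {}"
    by (auto simp: small_bins_def big_bins_def)
  moreover have "finite (big_bins t L f)"
    by (simp add: big_bins_def)
  ultimately show ?thesis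
    by (simp add: card_Un_disjoint)
qed

lemma card_big_bins_le_level:
  assumes "\<forall>x \<in> set L. 0 \<le> item_size x"
  shows "real (card (big_bins t L f)) * (1 - t) \<le> level L"
proof -
  have "(\<Sum>b\<in>big_bins t L f. 1 - t) \<le> (\<Sum>b\<in>big_bins t L f. level (bin L f b))"
    by (intro sum_mono) (auto simp: big_bins_def)
  also have "\<dots> \<le> (\<Sum>b\<in>bins_used L f. level (bin L f b))"
    using assms
    by (intro sum_mono2)
      (auto simp: big_bins_def level_def bin_def set_nths intro!: sum_list_nonneg)
  finally show ?thesis by (simp add: sum_level_bins)
qed

lemma small_bin_feasible:
  assumes "valid_packing L f" and "item_size x \<le> t" and "item_color x \<noteq> c"
    and "b \<in> small_bins t c L f"
  shows "b \<in> feasible_bins L f x"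
proof -
  have "alternating (bin L f b)"
    using assms(1,4) by (auto simp: small_bins_def valid_packing_def valid_bin_def)
  then show ?thesis
    using assms(2-4) by (auto simp: small_bins_def feasible_bins_def valid_bin_snoc_iff)
qed

lemma worst_fit_choice_small_bin:
  assumes "worst_fit_choice L f x b" and "valid_packing L f" and "item_size x \<le> t"
    and "item_color x \<noteq> c" and "small_bins t c L f \<noteq> {}"
  shows "b \<in> small_bins t c L f"
proof -
  obtain b' where b': "b' \<in> small_bins t c L f"
    using assms(5) by blast
  then have "b' \<in> feasible_bins L f x"
    using assms(2-4) by (intro small_bin_feasible)
  note choice = worst_fit_choice_least_level[OF assms(1) this]
  then have "b \<in> bins_used L f" and "item_color (last (bin L f b)) \<noteq> item_color x"
    by (auto simp: feasible_bins_def valid_bin_snoc_iff bin_eq_Nil_iff)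
  moreover from this(2) have "item_color (last (bin L f b)) = c"
    using assms(4) color_neq_iff by blast
  moreover have "level (bin L f b) \<le> 1 - t"
    using choice(2) b' by (simp add: small_bins_def)
  ultimately show ?thesis
    by (simp add: small_bins_def)
qed

lemma card_small_bins_snoc_le:
  assumes "item_color x = c"
  shows "card (small_bins t c (L @ [x]) f) \<le> card (small_bins t c L f) + 1"
proof -
  have "small_bins t c (L @ [x]) f \<subseteq> insert (f (length L)) (small_bins t c L f)"
    by (auto simp: small_bins_def bins_used_snoc bin_snoc split: if_splits)
  then have "card (small_bins t c (L @ [x]) f) \<le> card (insert (f (length L)) (small_bins t c L f))"
    by (intro card_mono) auto
  also have "\<dots> \<le> card (small_bins t c L f) + 1"
    by (simp add: card_insert_if)
  finally show ?thesis .
qed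

text \<open>The truncated subtraction expresses the reflection of the walk at zero.\<close>

lemma card_small_bins_snoc_opposite_le:
  assumes "worst_fit_choice L f x (f (length L))" and "valid_packing L f"
    and "item_size x \<le> t" and "item_color x \<noteq> c"
  shows "card (small_bins t c (L @ [x]) f) \<le> card (small_bins t c L f) - 1"
proof -
  have "small_bins t c (L @ [x]) f \<subseteq> small_bins t c L f - {f (length L)}"
    using assms(4) by (auto simp: small_bins_def bins_used_snoc bin_snoc split: if_splits)
  then have "card (small_bins t c (L @ [x]) f) \<le> card (small_bins t c L f - {f (length L)})"
    by (intro card_mono) auto
  also have "\<dots> = card (small_bins t c L f) - 1"
    using worst_fit_choice_small_bin[OF assms] by (cases "small_bins t c L f = {}") auto
  finally show ?thesis .
qed

lemma card_small_bins_le_excess_suffix: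
  assumes "worst_fit L f" and "\<forall>x \<in> set L. item_size x \<le> t" and "t \<le> 1"
  shows "\<exists>zs. suffix zs L \<and> int (card (small_bins t c L f)) \<le> excess c zs"
  using assms(1,2)
proof (induction L rule: rev_induct)
  case Nil
  show ?case by (simp add: small_bins_def)
next
  case (snoc x L)
  let ?n = "card (small_bins t c L f)" and ?n' = "card (small_bins t c (L @ [x]) f)"
  have wf: "worst_fit L f" and choice: "worst_fit_choice L f x (f (length L))"
    using snoc.prems(1) by (simp_all add: worst_fit_snoc_iff)
  obtain zs where zs: "suffix zs L" "int ?n \<le> excess c zs"
    using snoc.IH[OF wf] snoc.prems(2) by auto
  have "valid_packing L f"
    using wf snoc.prems(2) assms(3) by (intro worst_fit_valid_packing) auto
  then have opposite: "?n' \<le> ?n - 1" if "item_color x \<noteq> c"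
    using card_small_bins_snoc_opposite_le[OF choice] snoc.prems(2) that by simp
  show ?case
  proof (cases "item_color x \<noteq> c \<and> ?n = 0")
    case True
    then show ?thesis
      using opposite by (intro exI[of _ "[]"]) simp
  next
    case False
    have "int ?n' \<le> excess c (zs @ [x])"
    proof (cases "item_color x = c")
      case True
      then show ?thesis
        using card_small_bins_snoc_le[OF True, of t L f] zs(2) by simp
    next
      case opposite_color: False
      then have "int ?n' \<le> int ?n - 1"
        using False opposite by linarith
      then show ?thesis
        using opposite_color zs(2) by simp
    qed
    moreover have "suffix (zs @ [x]) (L @ [x])"
      using zs(1) by simp
    ultimately show ?thesis by blast
  qed
qed

lemma card_small_bins_le:
  assumes "worst_fit L f" and "\<forall>x \<in> set L. item_size x \<le> t" and "t \<le> 1"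
    and "valid_packing L g"
  shows "card (small_bins t Black L f) + card (small_bins t White L f) \<le> card (bins_used L g)"
proof -
  note suffix_bound = card_small_bins_le_excess_suffix[OF assms(1-3)]
  obtain bs where bs: "suffix bs L" "int (card (small_bins t Black L f)) \<le> excess Black bs"
    using suffix_bound by blast
  obtain ws where ws: "suffix ws L" "int (card (small_bins t White L f)) \<le> excess White ws"
    using suffix_bound by blast
  show ?thesis
    using excess_suffixes_le_card_bins_used[OF assms(4) bs(1) ws(1)] bs(2) ws(2) by simp
qed

theorem worst_fit_competitive:
  assumes "worst_fit L f" and "\<forall>x \<in> set L. 0 \<le> item_size x \<and> item_size x \<le> t" and "t < 1"
    and "valid_packing L g"
  shows "real (card (bins_used L f)) \<le> (1 + 1 / (1 - t)) * real (card (bins_used L g))"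
proof -
  have small: "card (small_bins t Black L f) + card (small_bins t White L f)
      \<le> card (bins_used L g)"
    using assms by (intro card_small_bins_le) auto
  have "real (card (big_bins t L f)) * (1 - t) \<le> level L"
    using assms(2) by (intro card_big_bins_le_level) simp
  also have "\<dots> \<le> real (card (bins_used L g))"
    using assms(4) by (rule level_le_card_bins_used)
  finally have big: "real (card (big_bins t L f)) \<le> 1 / (1 - t) * real (card (bins_used L g))"
    using assms(3) by (simp add: pos_le_divide_eq)
  show ?thesis
    using small big unfolding card_bins_used_eq_small_big[of L f t] distrib_right by linarith
qed

theorem theorem5p3:
  fixes d :: real and L :: "item list" and f :: "nat \<Rightarrow> nat"
  assumes "d \<ge> 2"
    and "\<forall>x \<in> set L. 0 \<le> item_size x \<and> item_size x \<le> 1"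
    and "\<forall>x \<in> set L. item_size x \<le> 1 / d"
    and "worst_fit L f"
  shows "real (card (bins_used L f)) \<le> (1 + d / (d - 1)) * real (OPT L)"
proof -
  obtain g where g: "valid_packing L g" "card (bins_used L g) = OPT L"
    using OPT_attained assms(2) by blast
  have "1 / d < 1" and ratio: "1 / (1 - 1 / d) = d / (d - 1)"
    using assms(1) by (simp_all add: field_simps)
  then have "real (card (bins_used L f)) \<le> (1 + 1 / (1 - 1 / d)) * real (OPT L)"
    using worst_fit_competitive[OF assms(4) _ _ g(1), of "1 / d"] assms(2,3) g(2) by simp
  then show ?thesis
    unfolding ratio .
qed

end
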